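(* Let $\mathcal{T}_p$ be the perfectoid Tate curve over a perfectoid field $K$ with parameter $q$, $0<|q|<1$. Then its (Čech) cohomology with coefficients in the structure sheaf satisfies $$H^i(\mathcal{O}_{\mathcal{T}_p},\mathcal{T}_p)\cong\begin{cases}K & i=0,1,\\ 0 & i\ge 2.\end{cases}$$
   Context: $p$ is the residue characteristic of $K$, and compatible roots $q^{1/p^j}$ are fixed. For radii $|r_1|\le|r_2|$ the annulus $\mathbb{B}(r_1,r_2)=\{|r_1|\le|X|\le|r_2|\}$ is given the ring $K\langle X/r_2,r_1/X\rangle_\infty=\bigcup_{j\ge0}K\langle (X/r_2)^{1/p^j},(r_1/X)^{1/p^j}\rangle$, i.e. series $\sum_{n\in\mathbb{Z}[1/p]}$ in the corresponding variables with coefficients tending to $0$. The perfectoid Tate curve $\mathcal{T}_p=\mathbb{G}_{m,K}/q^{\mathbb{Z}}$ is covered by $U_0=\mathbb{B}(q,q^{-1})$ (ring $K\langle qX,q/X\rangle_\infty$) and $U_1=\mathbb{B}(q^2,q)$ (ring $K\langle X/q,q^2/X\rangle_\infty$), with $U_0\cap U_1=U_{0,1,+}\sqcup U_{0,1,-}$ where $U_{0,1,+}=\mathbb{B}(q,q)$ (ring $K\langle X/q,q/X\rangle_\infty$) and $U_{0,1,-}=\mathbb{B}(q^2,q^2)$ (ring $K\langle X/q^2,q^2/X\rangle_\infty$), the latter being identified with the outer boundary $U_{0+}=\mathbb{B}(q^{-1},q^{-1})$ of $U_0$ via multiplication by $q^{-3}$ (ring map $X\mapsto X/q^3$). The cohomology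 is that of the Čech complex $\mathcal{O}(U_0)\oplus\mathcal{O}(U_1)\to\mathcal{O}(U_{0,1,+})\oplus\mathcal{O}(U_{0,1,-})\to0$ given by the difference of restriction maps. *)

theory Defs
  imports "HOL-Algebra.Algebraic_Closure_Type" "HOL-Algebra.Chinese_Remainder"
begin

section \<open>Perfectoid fields\<close>

text \<open>
  A perfectoid field of residue characteristic \<open>p\<close>: a field complete with respect to a
  nonarchimedean absolute value \<open>v\<close> whose value group is not discrete, such that \<open>p\<close> lies in the
  maximal ideal and Frobenius is surjective on \<open>O/pO\<close>, with \<open>O\<close> the ring of integers. The
  characteristic of the field may be \<open>0\<close> or \<open>p\<close>.
\<close>

locale perfectoid_field =
  fixes v :: "'k::field \<Rightarrow> real" and p :: nat
  assumes nonneg: "0 \<le> v x"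
    and eq_0_iff: "v x = 0 \<longleftrightarrow> x = 0"
    and mult: "v (x * y) = v x * v y"
    and ultrametric: "v (x + y) \<le> max (v x) (v y)"
    and complete:
      "(\<forall>e>0. \<exists>N. \<forall>m\<ge>N. \<forall>n\<ge>N. v (s m - s n) < e) \<Longrightarrow>
        \<exists>l. (\<lambda>n::nat. v (s n - l)) \<longlonglongrightarrow> 0"
    and nondiscrete: "\<not> (\<exists>g>0. v ` (UNIV - {0}) \<subseteq> range (\<lambda>n::int. g powi n))"
    and prime_p: "Factorial_Ring.prime p"
    and residue_char: "v (of_nat p) < 1"
    and frobenius_surj:
      "v x \<le> 1 \<Longrightarrow> \<exists>y z. v y \<le> 1 \<and> v z \<le> 1 \<and> x = y ^ p + of_nat p * z"


section \<open>Rings of functions on annuli\<close>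

definition p_inv_ints :: "nat \<Rightarrow> nat \<Rightarrow> rat set"
  where "p_inv_ints p j = {of_int m / of_nat p ^ j | m. True}"

text \<open>
  For a compatible system \<open>r j = q\<^bsup>1/p^j\<^esup>\<close>, this is \<open>q\<^sup>x\<close> for \<open>x \<in> \<int>[1/p]\<close> (and irrelevant for
  other \<open>x\<close>).
\<close>

definition root_pow :: "nat \<Rightarrow> (nat \<Rightarrow> 'k::field) \<Rightarrow> rat \<Rightarrow> 'k"
  where "root_pow p r x =
    (let j = (LEAST j. x \<in> p_inv_ints p j) in r j powi \<lfloor>x * of_nat p ^ j\<rfloor>)"

text \<open>
  A family \<open>c\<close> stands for the series \<open>\<Sum>n. c n X\<^sup>n\<close>. In terms of the variables \<open>X/r\<^sub>2\<close> and \<open>r\<^sub>1/X\<close>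
  with \<open>r\<^sub>1 = q\<^sup>a\<close>, \<open>r\<^sub>2 = q\<^sup>b\<close>, the \<open>n\<close>-th term is \<open>c n q\<^bsup>bn\<^esup> (X/r\<^sub>2)\<^sup>n\<close> if \<open>n \<ge> 0\<close> and
  \<open>c n q\<^bsup>an\<^esup> (r\<^sub>1/X)\<^bsup>-n\<^esup>\<close> if \<open>n < 0\<close>; these coefficients have to tend to \<open>0\<close>.
\<close>

definition annulus_series ::
    "('k::field \<Rightarrow> real) \<Rightarrow> nat \<Rightarrow> (nat \<Rightarrow> 'k) \<Rightarrow> rat set \<Rightarrow> int \<Rightarrow> int \<Rightarrow> (rat \<Rightarrow> 'k) set"
  where "annulus_series v p r E a b =
    {c. (\<forall>n. n \<notin> E \<longrightarrow> c n = 0) \<and>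
        ((\<lambda>n. v (c n * root_pow p r (of_int (if 0 \<le> n then b else a) * n))) \<longlongrightarrow> 0) cofinite}"

definition series_mult ::
    "('k::field \<Rightarrow> real) \<Rightarrow> (rat \<Rightarrow> 'k) \<Rightarrow> (rat \<Rightarrow> 'k) \<Rightarrow> rat \<Rightarrow> 'k"
  where "series_mult v c c' n =
    (THE s. ((\<lambda>F. v ((\<Sum>m\<in>F. c m * c' (n - m)) - s)) \<longlongrightarrow> 0) (finite_subsets_at_top UNIV))"

definition series_algebra ::
    "('k::field \<Rightarrow> real) \<Rightarrow> (rat \<Rightarrow> 'k) set \<Rightarrow> ('k, rat \<Rightarrow> 'k) module"
  where "series_algebra v S =
    \<lparr>carrier = S, monoid.mult = series_mult v, one = (\<lambda>n. if n = 0 then 1 else 0),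
     ring.zero = (\<lambda>n. 0), add = (\<lambda>c c' n. c n + c' n), module.smult = (\<lambda>k c n. k * c n)\<rparr>"

text \<open>
  The ring of the annulus \<open>|q\<^sup>a| \<le> |X| \<le> |q\<^sup>b|\<close>: first the union of the rings
  \<open>K\<langle>(X/q\<^sup>b)\<^bsup>1/p^j\<^esup>, (q\<^sup>a/X)\<^bsup>1/p^j\<^esup>\<rangle>\<close> over all \<open>j\<close>, where each series has exponents of bounded
  denominator, then its completion, consisting of all series with exponents in \<open>\<int>[1/p]\<close> whose
  coefficients tend to \<open>0\<close>.
\<close>

definition annulus_union ::
    "('k::field \<Rightarrow> real) \<Rightarrow> nat \<Rightarrow> (nat \<Rightarrow> 'k) \<Rightarrow> int \<Rightarrow> int \<Rightarrow> ('k, rat \<Rightarrow> 'k) module"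
  where "annulus_union v p r a b =
    series_algebra v (\<Union>j. annulus_series v p r (p_inv_ints p j) a b)"

definition annulus_completed ::
    "('k::field \<Rightarrow> real) \<Rightarrow> nat \<Rightarrow> (nat \<Rightarrow> 'k) \<Rightarrow> int \<Rightarrow> int \<Rightarrow> ('k, rat \<Rightarrow> 'k) module"
  where "annulus_completed v p r a b =
    series_algebra v (annulus_series v p r (\<Union>j. p_inv_ints p j) a b)"


section \<open>Cohomology of complexes of modules\<close>

text \<open>
  The multiplicative fields of a \<open>module\<close> record play no role in the \<open>module\<close> locale; those of
  the quotients below carry no meaning.
\<close>

definition module_dirsum ::
    "('r, 'a) module \<Rightarrow> ('r, 'b) module \<Rightarrow> ('r, 'a \<times> 'b) module"
  where "module_dirsum M N =
    ring.extend (RDirProd M N) (module.fields (\<lambda>k (x, y). (k \<odot>\<^bsub>M\<^esub> x, k \<odot>\<^bsub>N\<^esub> y)))"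

definition quotient_module :: "('r, 'a) module \<Rightarrow> 'a set \<Rightarrow> ('r, 'a set) module"
  where "quotient_module M B =
    ring.extend (M Quot B) (module.fields (\<lambda>k A. \<Union>x\<in>A. B +>\<^bsub>M\<^esub> (k \<odot>\<^bsub>M\<^esub> x)))"

definition module_iso ::
    "('r, 'm) ring_scheme \<Rightarrow> ('r, 'a) module \<Rightarrow> ('r, 'b) module \<Rightarrow> ('a \<Rightarrow> 'b) set"
  where "module_iso R M N =
    {h \<in> iso (add_monoid M) (add_monoid N).
      \<forall>k\<in>carrier R. \<forall>x\<in>carrier M. h (k \<odot>\<^bsub>M\<^esub> x) = k \<odot>\<^bsub>N\<^esub> h x}"

definition regular_module :: "'r ring \<Rightarrow> ('r, 'r) module"
  where "regular_module R = ring.extend R (module.fields (monoid.mult R))"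

definition cocycles ::
    "(nat \<Rightarrow> ('r, 'a) module) \<Rightarrow> (nat \<Rightarrow> 'a \<Rightarrow> 'a) \<Rightarrow> nat \<Rightarrow> 'a set"
  where "cocycles C d i = a_kernel (C i) (C (Suc i)) (d i)"

definition coboundaries ::
    "(nat \<Rightarrow> ('r, 'a) module) \<Rightarrow> (nat \<Rightarrow> 'a \<Rightarrow> 'a) \<Rightarrow> nat \<Rightarrow> 'a set"
  where "coboundaries C d i =
    (case i of 0 \<Rightarrow> {\<zero>\<^bsub>C 0\<^esub>} | Suc j \<Rightarrow> d j ` carrier (C j))"

definition cohomology ::
    "(nat \<Rightarrow> ('r, 'a) module) \<Rightarrow> (nat \<Rightarrow> 'a \<Rightarrow> 'a) \<Rightarrow> nat \<Rightarrow> ('r, 'a set) module"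
  where "cohomology C d i =
    quotient_module ((C i)\<lparr>carrier := cocycles C d i\<rparr>) (coboundaries C d i)"


section \<open>Cech complex of the perfectoid Tate curve\<close>

text \<open>
  Here \<open>A a b\<close> is the ring of the annulus \<open>|q\<^sup>a| \<le> |X| \<le> |q\<^sup>b|\<close>. The opens \<open>U\<^sub>0\<close>, \<open>U\<^sub>1\<close>,
  \<open>U\<^sub>0\<^sub>,\<^sub>1\<^sub>,\<^sub>+\<close>, \<open>U\<^sub>0\<^sub>,\<^sub>1\<^sub>,\<^sub>-\<close> correspond to \<open>(a, b) = (1, -1), (2, 1), (1, 1), (2, 2)\<close>.
\<close>

definition tate_cochains ::
    "(int \<Rightarrow> int \<Rightarrow> ('k, rat \<Rightarrow> 'k) module) \<Rightarrow> nat \<Rightarrow>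
      ('k, (rat \<Rightarrow> 'k) \<times> (rat \<Rightarrow> 'k)) module"
  where "tate_cochains A i =
    (if i = 0 then module_dirsum (A 1 (-1)) (A 2 1)
     else if i = 1 then module_dirsum (A 1 1) (A 2 2)
     else (module_dirsum (A 1 1) (A 2 2))\<lparr>carrier := {\<zero>\<^bsub>module_dirsum (A 1 1) (A 2 2)\<^esub>}\<rparr>)"

text \<open>
  \<open>X \<mapsto> X/q\<^sup>3\<close>, from the outer boundary \<open>|X| = |q\<^bsup>-1\<^esup>|\<close> of \<open>U\<^sub>0\<close> to \<open>|X| = |q\<^sup>2|\<close>.
\<close>

definition tate_glue :: "nat \<Rightarrow> (nat \<Rightarrow> 'k::field) \<Rightarrow> (rat \<Rightarrow> 'k) \<Rightarrow> rat \<Rightarrow> 'k"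
  where "tate_glue p r c = (\<lambda>n. c n * root_pow p r (- 3 * n))"

text \<open>
  All other restriction maps are restrictions of functions to smaller annuli, which do not change
  the series.
\<close>

definition tate_diff ::
    "nat \<Rightarrow> (nat \<Rightarrow> 'k::field) \<Rightarrow> nat \<Rightarrow> (rat \<Rightarrow> 'k) \<times> (rat \<Rightarrow> 'k) \<Rightarrow> (rat \<Rightarrow> 'k) \<times> (rat \<Rightarrow> 'k)"
  where "tate_diff p r i =
    (\<lambda>(f, g). if i = 0 then (\<lambda>n. f n - g n, \<lambda>n. tate_glue p r f n - g n)
              else (\<lambda>n. 0, \<lambda>n. 0))"

definition tate_cohomology ::
    "nat \<Rightarrow> (nat \<Rightarrow> 'k::field) \<Rightarrow> (int \<Rightarrow> int \<Rightarrow> ('k, rat \<Rightarrow> 'k) module) \<Rightarrow> nat \<Rightarrow>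
      ('k, ((rat \<Rightarrow> 'k) \<times> (rat \<Rightarrow> 'k)) set) module"
  where "tate_cohomology p r A i = cohomology (tate_cochains A) (tate_diff p r) i"

end

theory Submission
  imports Defs
begin

text \<open>
  Everything happens coefficientwise. The coefficient of \<open>X\<^sup>n\<close> contributes the complex
  \<open>K\<^sup>2 \<rightarrow> K\<^sup>2\<close>, \<open>(f, g) \<mapsto> (f - g, q\<^bsup>-3n\<^esup> f - g)\<close>, with determinant \<open>q\<^bsup>-3n\<^esup> - 1\<close>. For \<open>n \<noteq> 0\<close> the
  ultrametric inequality gives \<open>|1 - q\<^bsup>-3n\<^esup>| = max 1 |q|\<^bsup>-3n\<^esup>\<close> exactly, however small \<open>n\<close> is, so the
  inverse is bounded for the Gauss norms and preserves convergence. Only \<open>n = 0\<close> contributes to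
  the cohomology, one copy of \<open>K\<close> in each of the degrees \<open>0\<close> and \<open>1\<close>.
\<close>

section \<open>Quotients of modules\<close>

text \<open>First isomorphism theorem for a surjective linear functional with kernel
  \<open>B\<close>. In degree 0 the functional is the constant term, in degree 1 the difference of
  two constant terms.\<close>

lemma quotient_module_iso_regular:
  fixes M :: "('k::field, 'a) module" and h :: "'a \<Rightarrow> 'k"
  assumes M: "abelian_group M"
    and smult: "\<And>k x. x \<in> carrier M \<Longrightarrow> k \<odot>\<^bsub>M\<^esub> x \<in> carrier M"
    and h_add: "\<And>x y. x \<in> carrier M \<Longrightarrow> y \<in> carrier M \<Longrightarrow> h (x \<oplus>\<^bsub>M\<^esub> y) = h x + h y"
    and h_smult: "\<And>k x. x \<in> carrier M \<Longrightarrow> h (k \<odot>\<^bsub>M\<^esub> x) = k * h x"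
    and h_surj: "h ` carrier M = UNIV"
    and B: "B = {x \<in> carrier M. h x = 0}"
  shows "module_iso ring_of_type_algebra (quotient_module M B)
           (regular_module (ring_of_type_algebra :: 'k ring)) \<noteq> {}"
proof -
  let ?G = "add_monoid M"
  let ?R = "regular_module (ring_of_type_algebra :: 'k ring)"
  interpret M: abelian_group M by (fact M)
  have R: "carrier ?R = UNIV" "add ?R = (+)" "ring.zero ?R = 0" "module.smult ?R = (*)"
    by (simp_all add: regular_module_def ring.defs module.defs ring_of_type_algebra_def)
  have "comm_group (add_monoid ?R)"
    by (rule comm_groupI) (auto simp: R add.assoc add.commute intro: exI[of _ "- _"] left_minus)
  then have gR: "group (add_monoid ?R)"
    by (simp add: comm_group_def)
  interpret gh: group_hom ?G "add_monoid ?R" h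
    by (intro group_hom.intro group_hom_axioms.intro gR)
       (auto simp: hom_def R h_add M.add.is_group)
  have ker: "kernel ?G (add_monoid ?R) h = B"
    by (auto simp: kernel_def R B)
  have Q: "carrier (quotient_module M B) = carrier (?G Mod B)"
    "add (quotient_module M B) = monoid.mult (?G Mod B)"
    by (simp_all add: quotient_module_def ring.defs module.defs FactRing_def FactGroup_def
        A_RCOSETS_def set_add_def)
  have iso: "(\<lambda>C. the_elem (h ` C)) \<in> iso (add_monoid (quotient_module M B)) (add_monoid ?R)"
    using gh.FactGroup_iso_set h_surj unfolding ker by (simp add: R Q iso_def hom_def)
  \<comment> \<open>Cosets are the fibres of \<open>h\<close>. Hence the union over representatives
    that defines scalar multiplication on the quotient collapses to a single coset.\<close>
  have coset: "B +>\<^bsub>M\<^esub> x = {y \<in> carrier M. h y = h x}" if x: "x \<in> carrier M" for x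
  proof (intro equalityI subsetI)
    fix y assume "y \<in> B +>\<^bsub>M\<^esub> x"
    then show "y \<in> {y \<in> carrier M. h y = h x}"
      using x by (auto simp: a_r_coset_def' B h_add)
  next
    fix y assume y: "y \<in> {y \<in> carrier M. h y = h x}"
    have "h (y \<ominus>\<^bsub>M\<^esub> x) + h x = h y"
      using x y by (subst h_add[symmetric]) (auto simp: M.minus_eq M.a_assoc M.l_neg)
    then have "y \<ominus>\<^bsub>M\<^esub> x \<in> B" "y = (y \<ominus>\<^bsub>M\<^esub> x) \<oplus>\<^bsub>M\<^esub> x"
      using x y by (auto simp: B M.minus_eq M.a_assoc M.l_neg)
    then show "y \<in> B +>\<^bsub>M\<^esub> x"
      by (auto simp: a_r_coset_def')
  qed
  have val: "the_elem (h ` (B +>\<^bsub>M\<^esub> x)) = h x" if "x \<in> carrier M" for x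
  proof -
    have "h ` (B +>\<^bsub>M\<^esub> x) = {h x}"
      using that by (auto simp: coset)
    then show ?thesis by simp
  qed
  have "the_elem (h ` (k \<odot>\<^bsub>quotient_module M B\<^esub> C)) = k \<odot>\<^bsub>?R\<^esub> the_elem (h ` C)"
    if C: "C \<in> carrier (quotient_module M B)" for k C
  proof -
    obtain x where x: "x \<in> carrier M" "C = B +>\<^bsub>M\<^esub> x"
      using C by (auto simp: quotient_module_def ring.defs module.defs FactRing_def A_RCOSETS_def'
          a_r_coset_def')
    have "k \<odot>\<^bsub>quotient_module M B\<^esub> C = (\<Union>y\<in>C. B +>\<^bsub>M\<^esub> (k \<odot>\<^bsub>M\<^esub> y))"
      by (simp add: quotient_module_def ring.defs module.defs)
    also have "\<dots> = B +>\<^bsub>M\<^esub> (k \<odot>\<^bsub>M\<^esub> x)"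
      using x by (auto simp: coset smult h_smult)
    finally show ?thesis
      using x by (simp add: val smult h_smult R)
  qed
  with iso show ?thesis
    unfolding module_iso_def by blast
qed

text \<open>No group axioms are assumed, so \<open>0 + 0 = 0\<close> is a hypothesis: it identifies
  the only coset \<open>B + 0\<close> with \<open>B\<close>.\<close>

lemma carrier_quotient_module_trivial:
  assumes "carrier M = {\<zero>\<^bsub>M\<^esub>}" and "B = {\<zero>\<^bsub>M\<^esub>}" and "\<zero>\<^bsub>M\<^esub> \<oplus>\<^bsub>M\<^esub> \<zero>\<^bsub>M\<^esub> = \<zero>\<^bsub>M\<^esub>"
  shows "carrier (quotient_module M B) = {\<zero>\<^bsub>quotient_module M B\<^esub>}"
  using assms
  by (simp add: quotient_module_def ring.defs module.defs FactRing_def A_RCOSETS_def' a_r_coset_def')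


section \<open>Valuations\<close>

context perfectoid_field
begin

lemma val_0 [simp]: "v 0 = 0"
  by (simp add: eq_0_iff)

lemma val_1 [simp]: "v 1 = 1"
  using mult[of 1 1] eq_0_iff[of 1] by simp

lemma val_power: "v (x ^ n) = v x ^ n"
  by (induction n) (simp_all add: mult)

lemma val_inverse: "v (inverse x) = inverse (v x)"
proof (cases "x = 0")
  case False
  then have "v x * v (inverse x) = 1"
    by (simp flip: mult)
  then show ?thesis
    by (metis inverse_unique)
qed simp

lemma val_divide: "v (x / y) = v x / v y"
  by (simp add: divide_inverse mult val_inverse)

lemma val_powi: "v (x powi m) = v x powi m"
  by (simp add: power_int_def val_power val_inverse)

lemma val_minus [simp]: "v (- x) = v x"
proof -
  have "v (-1) ^ 2 = 1"
    by (simp flip: val_power)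
  then have "v (-1) = 1"
    using nonneg[of "-1"] by (simp add: power2_eq_1_iff)
  then show ?thesis
    using mult[of "-1" x] by simp
qed

lemma val_diff_le: "v (x - y) \<le> max (v x) (v y)"
  using ultrametric[of x "- y"] by simp

lemma val_add_le: "v (x + y) \<le> v x + v y"
  using ultrametric[of x y] nonneg[of x] nonneg[of y] by linarith

lemma val_diff_le_add: "v (x - y) \<le> v x + v y"
  using val_add_le[of x "- y"] by simp

text \<open>Isosceles triangle principle: if say \<open>v y < v x\<close>, then
  \<open>v x \<le> max (v (x - y)) (v y)\<close> forces \<open>v x \<le> v (x - y)\<close>.\<close>

lemma val_diff_eq_max:
  assumes "v x \<noteq> v y"
  shows "v (x - y) = max (v x) (v y)"
  using assms val_diff_le[of x y] val_diff_le[of x "x - y"] ultrametric[of "x - y" y]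
  by (auto simp: max_def split: if_splits)

section \<open>Exponents in Z[1/p] and absolute values of powers of q\<close>

lemma p_pos: "0 < p"
  using prime_p prime_gt_0_nat by blast

lemma p_inv_ints_mono:
  assumes "i \<le> j"
  shows "p_inv_ints p i \<subseteq> p_inv_ints p j"
proof
  fix x assume "x \<in> p_inv_ints p i"
  then obtain m where "x = of_int m / of_nat p ^ i"
    by (auto simp: p_inv_ints_def)
  moreover obtain d where "j = i + d"
    using assms le_iff_add by blast
  ultimately have "x = of_int (m * int p ^ d) / of_nat p ^ j"
    using p_pos by (simp add: power_add)
  then show "x \<in> p_inv_ints p j"
    unfolding p_inv_ints_def by blast
qed

lemma p_inv_ints_of_int_mult:
  assumes "x \<in> p_inv_ints p j"
  shows "of_int k * x \<in> p_inv_ints p j"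
proof -
  obtain m where "x = of_int m / of_nat p ^ j"
    using assms by (auto simp: p_inv_ints_def)
  then have "of_int k * x = of_int (k * m) / of_nat p ^ j"
    by simp
  then show ?thesis
    unfolding p_inv_ints_def by blast
qed

lemma zero_in_p_inv_ints: "0 \<in> p_inv_ints p j"
  by (auto simp: p_inv_ints_def intro: exI[of _ 0])

text \<open>\<open>root_pow\<close> uses the least level at which \<open>x\<close> is defined, but
  \<open>r j\<close> is a \<open>p^j\<close>-th root of \<open>q\<close> at every level, so the
  absolute value does not depend on the level.\<close>

lemma val_root_pow:
  assumes "0 < v q" and "r 0 = q" and "\<forall>j. r (Suc j) ^ p = r j" and "x \<in> p_inv_ints p i"
  shows "v (root_pow p r x) = v q powr real_of_rat x"
proof -
  define j where "j = (LEAST j. x \<in> p_inv_ints p j)"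
  have "x \<in> p_inv_ints p j"
    unfolding j_def using assms(4) by (rule LeastI)
  then obtain m where m: "x = of_int m / of_nat p ^ j"
    by (auto simp: p_inv_ints_def)
  have "r j ^ (p ^ j) = q" for j
    using assms(2,3) by (induction j) (simp_all add: power_mult)
  then have pw: "v (r j) ^ (p ^ j) = v q"
    by (simp flip: val_power)
  have pos: "0 < v (r j)"
    using pw assms(1) nonneg[of "r j"] p_pos by (cases "v (r j) = 0") (auto simp: power_0_left)
  have "v (root_pow p r x) = v (r j) powi m"
    using p_pos unfolding root_pow_def j_def[symmetric] Let_def by (simp add: m val_powi)
  also have "\<dots> = v (r j) powr (real (p ^ j) * real_of_rat x)"
    using pos p_pos by (simp add: m powr_real_of_int' of_rat_divide of_rat_power)
  also have "\<dots> = v q powr real_of_rat x"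
    using powr_realpow[OF pos, of "p ^ j"] by (simp add: pw flip: powr_powr)
  finally show ?thesis .
qed

lemma root_pow_0: "root_pow p r 0 = 1"
  by (simp add: root_pow_def)

end


section \<open>Series on annuli\<close>

locale tate_curve = perfectoid_field v p for v :: "'k::field \<Rightarrow> real" and p +
  fixes q :: 'k and r :: "nat \<Rightarrow> 'k"
  assumes val_q_pos: "0 < v q" and val_q_less_1: "v q < 1"
    and r_0: "r 0 = q" and r_Suc: "\<forall>j. r (Suc j) ^ p = r j"
begin

text \<open>The convergence condition with \<open>root_pow\<close> replaced by its absolute value, a
  real power of \<open>v q\<close>. Its exponents add for all rationals, so no multiplicativity of
  \<open>root_pow\<close> itself has to be established.\<close>

definition decays :: "int \<Rightarrow> int \<Rightarrow> (rat \<Rightarrow> 'k) \<Rightarrow> bool"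
  where "decays a b c \<longleftrightarrow>
    ((\<lambda>n. v (c n) * v q powr (of_int (if 0 \<le> n then b else a) * real_of_rat n)) \<longlongrightarrow> 0) cofinite"

lemma annulus_series_iff:
  assumes "E \<subseteq> (\<Union>j. p_inv_ints p j)"
  shows "c \<in> annulus_series v p r E a b \<longleftrightarrow> (\<forall>n. n \<notin> E \<longrightarrow> c n = 0) \<and> decays a b c"
proof -
  have "v (c n * root_pow p r (of_int k * n)) = v (c n) * v q powr (of_int k * real_of_rat n)"
    if "\<forall>n. n \<notin> E \<longrightarrow> c n = 0" for n k
  proof (cases "n \<in> E")
    case True
    then obtain j where "n \<in> p_inv_ints p j"
      using assms by auto
    then show ?thesis
      using val_root_pow[OF val_q_pos r_0 r_Suc p_inv_ints_of_int_mult, of n j k]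
      by (simp add: mult of_rat_mult)
  qed (use that in simp)
  then show ?thesis
    unfolding annulus_series_def decays_def by auto
qed

text \<open>Comparison test against two series, possibly on two other annuli. It reduces convergence
  of a combined series to a termwise inequality of weights.\<close>

lemma decays_bound:
  assumes d: "decays a1 b1 d" and e: "decays a2 b2 e"
    and le: "\<And>n. v (c n) * v q powr (of_int (if 0 \<le> n then b else a) * real_of_rat n) \<le>
      v (d n) * v q powr (of_int (if 0 \<le> n then b1 else a1) * real_of_rat n) +
      v (e n) * v q powr (of_int (if 0 \<le> n then b2 else a2) * real_of_rat n)"
  shows "decays a b c"
  unfolding decays_def
proof (rule tendsto_sandwich[OF _ _ tendsto_const])
  show "((\<lambda>n. v (d n) * v q powr (of_int (if 0 \<le> n then b1 else a1) * real_of_rat n) +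
      v (e n) * v q powr (of_int (if 0 \<le> n then b2 else a2) * real_of_rat n)) \<longlongrightarrow> 0) cofinite"
    using tendsto_add[OF d[unfolded decays_def] e[unfolded decays_def]] by simp
qed (use le nonneg in auto)

lemma decays_add:
  assumes "decays a b c" and "decays a b d"
  shows "decays a b (\<lambda>n. c n + d n)"
  by (rule decays_bound[OF assms]) (simp add: val_add_le mult_right_mono flip: distrib_right)

lemma decays_const_mult:
  assumes "decays a b c"
  shows "decays a b (\<lambda>n. k * c n)"
  using tendsto_mult_left[OF assms[unfolded decays_def], of "v k"]
  by (simp add: decays_def mult mult.assoc)

lemma decays_finite:
  assumes "finite {n. c n \<noteq> 0}"
  shows "decays a b c"
  unfolding decays_def
  by (rule tendsto_eventually) (use assms in \<open>auto simp: eventually_cofinite elim: rev_finite_subset\<close>)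

section \<open>The denominators 1 - q^(-3n)\<close>

lemma val_root_pow_minus_3:
  assumes "n \<in> p_inv_ints p j"
  shows "v (root_pow p r (- 3 * n)) = v q powr (- 3 * real_of_rat n)"
  using val_root_pow[OF val_q_pos r_0 r_Suc p_inv_ints_of_int_mult[OF assms, of "-3"]]
  by (simp add: of_rat_mult of_rat_minus)

text \<open>As \<open>0 < v q < 1\<close> and \<open>n \<noteq> 0\<close>, the two terms have
  different absolute values, so the isosceles principle applies. In particular the denominator never
  has absolute value below 1.\<close>

lemma val_1_minus_root_pow:
  assumes "n \<in> p_inv_ints p j" and "n \<noteq> 0"
  shows "v (1 - root_pow p r (- 3 * n)) = max 1 (v q powr (- 3 * real_of_rat n))"
proof -
  have "v (root_pow p r (- 3 * n)) = v q powr (- 3 * real_of_rat n)"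
    using assms(1) by (rule val_root_pow_minus_3)
  moreover have "v q powr (- 3 * real_of_rat n) \<noteq> 1"
    using assms(2) val_q_pos val_q_less_1 by (simp add: powr_eq_one_iff_gen)
  ultimately show ?thesis
    by (subst val_diff_eq_max) auto
qed

lemma powr_val_q_mono: "x \<le> y \<Longrightarrow> v q powr y \<le> v q powr x"
  using val_q_pos val_q_less_1 by (simp add: powr_mono')

end


section \<open>The Cech complex\<close>

lemma series_algebra_simps:
  "carrier (series_algebra v S) = S"
  "add (series_algebra v S) = (\<lambda>c c' n. c n + c' n)"
  "ring.zero (series_algebra v S) = (\<lambda>n. 0)"
  "module.smult (series_algebra v S) = (\<lambda>k c n. k * c n)"
  by (simp_all add: series_algebra_def)

lemma module_dirsum_simps:
  "carrier (module_dirsum M N) = carrier M \<times> carrier N"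
  "add (module_dirsum M N) = (\<lambda>(x, y) (x', y'). (x \<oplus>\<^bsub>M\<^esub> x', y \<oplus>\<^bsub>N\<^esub> y'))"
  "ring.zero (module_dirsum M N) = (\<zero>\<^bsub>M\<^esub>, \<zero>\<^bsub>N\<^esub>)"
  "module.smult (module_dirsum M N) = (\<lambda>k (x, y). (k \<odot>\<^bsub>M\<^esub> x, k \<odot>\<^bsub>N\<^esub> y))"
  by (simp_all add: module_dirsum_def ring.defs module.defs RDirProd_def DirProd_def monoid.defs)

text \<open>
  The set \<open>\<E>\<close> consists of the admissible sets of exponents: all \<open>p\<^bsup>-j\<^esup>\<int>\<close> for the union, only
  \<open>\<int>[1/p]\<close> for the completion.
\<close>

locale tate_cover = tate_curve v p q r
  for v :: "'k::field \<Rightarrow> real" and p and q :: 'k and r +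
  fixes \<E> :: "rat set set"
  assumes nonempty: "\<E> \<noteq> {}"
    and directed: "E \<in> \<E> \<Longrightarrow> F \<in> \<E> \<Longrightarrow> \<exists>G\<in>\<E>. E \<union> F \<subseteq> G"
    and exponents: "E \<in> \<E> \<Longrightarrow> E \<subseteq> (\<Union>j. p_inv_ints p j)"
    and zero_in: "E \<in> \<E> \<Longrightarrow> 0 \<in> E"
begin

section \<open>Series with admissible exponents\<close>

definition supported :: "(rat \<Rightarrow> 'k) \<Rightarrow> bool"
  where "supported c \<longleftrightarrow> (\<exists>E\<in>\<E>. \<forall>n. n \<notin> E \<longrightarrow> c n = 0)"

text \<open>Directedness of \<open>\<E>\<close> provides one exponent set for both series. The index
  0 is exempt because 0 lies in every admissible set.\<close>

lemma supported_combine: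
  assumes "supported c" and "supported d" and "\<And>n. c n = 0 \<Longrightarrow> d n = 0 \<Longrightarrow> n \<noteq> 0 \<Longrightarrow> e n = 0"
  shows "supported e"
proof -
  obtain E F where EF: "E \<in> \<E>" "F \<in> \<E>"
    and c: "\<forall>n. n \<notin> E \<longrightarrow> c n = 0" and d: "\<forall>n. n \<notin> F \<longrightarrow> d n = 0"
    using assms(1,2) unfolding supported_def by blast
  obtain G where G: "G \<in> \<E>" "E \<union> F \<subseteq> G"
    using directed[OF EF] by blast
  have "e n = 0" if "n \<notin> G" for n
    using that G c d zero_in[OF G(1)] by (intro assms(3)) auto
  with G(1) show ?thesis
    unfolding supported_def by blast
qed

lemma supported_at_0: "(\<And>n. n \<noteq> 0 \<Longrightarrow> c n = 0) \<Longrightarrow> supported c"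
  using nonempty zero_in unfolding supported_def by (metis all_not_in_conv)

text \<open>The case split behind the termwise estimates: either the coefficient vanishes, or
  \<open>n\<close> lies in Z[1/p] and the formulas for \<open>root_pow\<close> apply.\<close>

lemma supported_cases:
  assumes "supported c"
  obtains "c n = 0" | j where "n \<in> p_inv_ints p j"
proof -
  obtain E where "E \<in> \<E>" "\<forall>n. n \<notin> E \<longrightarrow> c n = 0"
    using assms unfolding supported_def by blast
  then show thesis
    using exponents[of E] that by (cases "n \<in> E") auto
qed

text \<open>The common form of the carriers of \<open>annulus_union\<close> and
  \<open>annulus_completed\<close>, for suitable \<open>\<E>\<close>.\<close>

definition series :: "int \<Rightarrow> int \<Rightarrow> (rat \<Rightarrow> 'k) set"
  where "series a b = {c. supported c \<and> decays a b c}"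

lemma series_add:
  assumes "c \<in> series a b" and "d \<in> series a b"
  shows "(\<lambda>n. c n + d n) \<in> series a b"
  using assms supported_combine[of c d "\<lambda>n. c n + d n"] by (simp add: series_def decays_add)

lemma series_smult:
  assumes "c \<in> series a b"
  shows "(\<lambda>n. k * c n) \<in> series a b"
  using assms supported_combine[of c c "\<lambda>n. k * c n"] by (simp add: series_def decays_const_mult)

lemma series_at_0:
  assumes "\<And>n. n \<noteq> 0 \<Longrightarrow> c n = 0"
  shows "c \<in> series a b"
proof -
  have "{n. c n \<noteq> 0} \<subseteq> {0}"
    using assms by auto
  then show ?thesis
    using assms by (auto simp: series_def intro!: supported_at_0 decays_finite elim: finite_subset)
qed

section \<open>Modules of pairs and the restriction maps\<close>

abbreviation series_pairs :: "int \<Rightarrow> int \<Rightarrow> int \<Rightarrow> int \<Rightarrow> ('k, (rat \<Rightarrow> 'k) \<times> (rat \<Rightarrow> 'k)) module"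
  where "series_pairs a b a' b' \<equiv>
    module_dirsum (series_algebra v (series a b)) (series_algebra v (series a' b'))"

lemma submodule_abelian_group:
  assumes sub: "Z \<subseteq> carrier (series_pairs a b a' b')"
    and zero: "(\<lambda>n. 0, \<lambda>n. 0) \<in> Z"
    and add: "\<And>f g f' g'. (f, g) \<in> Z \<Longrightarrow> (f', g') \<in> Z \<Longrightarrow> (\<lambda>n. f n + f' n, \<lambda>n. g n + g' n) \<in> Z"
    and smult: "\<And>k f g. (f, g) \<in> Z \<Longrightarrow> (\<lambda>n. k * f n, \<lambda>n. k * g n) \<in> Z"
  shows "abelian_group ((series_pairs a b a' b')\<lparr>carrier := Z\<rparr>)"
proof (rule abelian_groupI, goal_cases)
  \<comment> \<open>Existence of additive inverses, obtained from closure under the scalar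
    -1.\<close>
  case (6 x)
  obtain f g where x: "x = (f, g)" by fastforce
  show ?case
    using smult[of f g "-1"] 6
    by (intro bexI[of _ "(\<lambda>n. -1 * f n, \<lambda>n. -1 * g n)"])
       (auto simp: x module_dirsum_simps series_algebra_simps)
qed (use assms in \<open>auto simp: module_dirsum_simps series_algebra_simps add.assoc add.commute\<close>)

text \<open>The circle \<open>|X| = |q|\<close> lies in both annuli, so each term is no larger there
  than in the norm of either annulus.\<close>

lemma series_diff_inner:
  assumes f: "f \<in> series 1 (- 1)" and g: "g \<in> series 2 1"
  shows "(\<lambda>n. f n - g n) \<in> series 1 1"
proof -
  have "decays 1 1 (\<lambda>n. f n - g n)"
  proof (rule decays_bound)
    fix n :: rat
    define t where "t = real_of_rat n"
    have "v (f n) * v q powr t \<le> v (f n) * v q powr (of_int (if 0 \<le> n then - 1 else 1) * t)"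
      "v (g n) * v q powr t \<le> v (g n) * v q powr (of_int (if 0 \<le> n then 1 else 2) * t)"
      by (intro mult_left_mono powr_val_q_mono; simp add: t_def nonneg)+
    then show "v (f n - g n) * v q powr (of_int (if 0 \<le> n then 1 else 1) * real_of_rat n) \<le>
      v (f n) * v q powr (of_int (if 0 \<le> n then - 1 else 1) * real_of_rat n) +
      v (g n) * v q powr (of_int (if 0 \<le> n then 1 else 2) * real_of_rat n)"
      using mult_right_mono[OF val_diff_le_add[of "f n" "g n"], of "v q powr t"]
      unfolding t_def[symmetric] by (simp add: distrib_right)
  qed (use f g in \<open>simp_all add: series_def\<close>)
  then show ?thesis
    using f g supported_combine[of f g "\<lambda>n. f n - g n"] by (simp add: series_def)
qed

lemma val_tate_glue:
  assumes "supported f"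
  shows "v (tate_glue p r f n) = v (f n) * v q powr (- 3 * real_of_rat n)"
  using assms
  by (rule supported_cases[of f n])
     (use val_root_pow_minus_3 in \<open>auto simp: tate_glue_def mult\<close>)

text \<open>Gluing multiplies the coefficient by \<open>q^(-3n)\<close>, which turns the weight
  \<open>|q|^(2n)\<close> of the circle \<open>|X| = |q^2|\<close> into \<open>|q|^(-n)\<close>, the
  weight of the outer boundary of \<open>U_0\<close>.\<close>

lemma series_diff_outer:
  assumes f: "f \<in> series 1 (- 1)" and g: "g \<in> series 2 1"
  shows "(\<lambda>n. tate_glue p r f n - g n) \<in> series 2 2"
proof -
  have "decays 2 2 (\<lambda>n. tate_glue p r f n - g n)"
  proof (rule decays_bound)
    fix n :: rat
    define t where "t = real_of_rat n"
    have "v (tate_glue p r f n) * v q powr (2 * t) = v (f n) * v q powr (- t)"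
      using f by (simp add: val_tate_glue series_def t_def flip: powr_add)
    moreover have
      "v (f n) * v q powr (- t) \<le> v (f n) * v q powr (of_int (if 0 \<le> n then - 1 else 1) * t)"
      "v (g n) * v q powr (2 * t) \<le> v (g n) * v q powr (of_int (if 0 \<le> n then 1 else 2) * t)"
      by (intro mult_left_mono powr_val_q_mono; simp add: t_def nonneg)+
    ultimately show
      "v (tate_glue p r f n - g n) * v q powr (of_int (if 0 \<le> n then 2 else 2) * real_of_rat n) \<le>
      v (f n) * v q powr (of_int (if 0 \<le> n then - 1 else 1) * real_of_rat n) +
      v (g n) * v q powr (of_int (if 0 \<le> n then 1 else 2) * real_of_rat n)"
      using mult_right_mono[OF val_diff_le_add[of "tate_glue p r f n" "g n"], of "v q powr (2 * t)"]
      unfolding t_def[symmetric] by (simp add: distrib_right)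
  qed (use f g in \<open>simp_all add: series_def\<close>)
  then show ?thesis
    using f g supported_combine[of f g "\<lambda>n. tate_glue p r f n - g n"]
    by (simp add: series_def tate_glue_def)
qed

section \<open>Kernel and image of the differential, coefficient by coefficient\<close>

lemma root_pow_minus_3_neq_1:
  assumes "n \<in> p_inv_ints p j" and "n \<noteq> 0"
  shows "root_pow p r (- 3 * n) \<noteq> 1"
  using val_1_minus_root_pow[OF assms] by (auto simp: max_def split: if_splits)

text \<open>Subtracting the equations \<open>f - g = h\<close> and \<open>q^(-3n) f - g = k\<close>
  leaves \<open>(1 - q^(-3n)) f = h - k\<close>. At \<open>n = 0\<close> this is the condition
  \<open>h 0 = k 0\<close>, which is thus the only obstruction.\<close>

lemma tate_diff_solvable:
  assumes h: "h \<in> series 1 1" and k: "k \<in> series 2 2" and h0: "h 0 = k 0"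
  obtains f g where "f \<in> series 1 (- 1)" and "g \<in> series 2 1"
    and "h = (\<lambda>n. f n - g n)" and "k = (\<lambda>n. tate_glue p r f n - g n)"
proof -
  \<comment> \<open>The value \<open>f 0\<close> is free; the choice \<open>h 0\<close> makes
    \<open>g 0 = 0\<close>.\<close>
  define f where "f n = (if n = 0 then h 0 else (h n - k n) / (1 - root_pow p r (- 3 * n)))" for n
  define g where "g n = f n - h n" for n
  \<comment> \<open>Comparison series for \<open>g\<close>: \<open>g = f - h\<close> is used for
    \<open>n \<ge> 0\<close> and the gluing equation, with \<open>k\<close>, for
    \<open>n < 0\<close>. The weights of \<open>U_1\<close> there are exactly those of
    \<open>h\<close> and \<open>k\<close>.\<close>
  define e where "e n = (if 0 \<le> n then h n else k n)" for n
  have sf: "supported f"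
    by (rule supported_combine[of h k]) (use h k in \<open>auto simp: series_def f_def\<close>)
  have sg: "supported g"
    by (rule supported_combine[of h f]) (use h sf in \<open>auto simp: series_def g_def\<close>)
  have g': "g n = tate_glue p r f n - k n" for n
  proof (cases "n = 0")
    case True
    then show ?thesis
      using h0 by (simp add: g_def f_def tate_glue_def root_pow_0)
  next
    case False
    \<comment> \<open>Indicator of the joint support: outside Z[1/p] both \<open>h n\<close> and
      \<open>k n\<close> vanish, so a nonzero denominator is needed only inside.\<close>
    have "supported (\<lambda>n. if h n = 0 \<and> k n = 0 then 0 else 1)"
      by (rule supported_combine[of h k]) (use h k in \<open>auto simp: series_def\<close>)
    then show ?thesis
    proof (rule supported_cases[of _ n])
      fix j assume "n \<in> p_inv_ints p j"
      then have "root_pow p r (- 3 * n) \<noteq> 1"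
        using False by (rule root_pow_minus_3_neq_1)
      then show ?thesis
        using False by (simp add: g_def f_def tate_glue_def field_simps)
    qed (use False in \<open>auto simp: g_def f_def tate_glue_def split: if_splits\<close>)
  qed
  have df: "decays 1 (- 1) f"
  proof (rule decays_bound)
    fix n :: rat
    define t where "t = real_of_rat n"
    define w where "w = v q powr (of_int (if 0 \<le> n then - 1 else 1) * t)"
    \<comment> \<open>The denominator has absolute value at least \<open>|q|^(-3t)\<close> and at
      least 1; the first bound is used for \<open>n \<ge> 0\<close>, the second for
      \<open>n < 0\<close>.\<close>
    have "v (f n) \<le> (v (h n) + v (k n)) * v q powr (if 0 \<le> n then 3 * t else 0)"
      using sf
    proof (rule supported_cases[of f n])
      fix j assume n: "n \<in> p_inv_ints p j"
      show ?thesis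
      proof (cases "n = 0")
        case True
        then show ?thesis
          using val_q_pos nonneg by (simp add: f_def t_def)
      next
        case False
        have "v (f n) = v (h n - k n) / max 1 (v q powr (- 3 * t))"
          unfolding t_def using val_1_minus_root_pow[OF n False] False by (simp add: f_def val_divide)
        also have "\<dots> \<le> (v (h n) + v (k n)) / v q powr (if 0 \<le> n then - 3 * t else 0)"
          using val_q_pos nonneg val_diff_le_add by (intro frac_le) auto
        also have "\<dots> = (v (h n) + v (k n)) * v q powr (if 0 \<le> n then 3 * t else 0)"
          by (simp add: powr_minus field_simps)
        finally show ?thesis .
      qed
    qed (simp add: nonneg)
    then have "v (f n) * w \<le> (v (h n) + v (k n)) * (v q powr (if 0 \<le> n then 3 * t else 0) * w)"
      by (simp add: w_def mult_right_mono flip: mult.assoc)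
    also have "v q powr (if 0 \<le> n then 3 * t else 0) * w = v q powr (if 0 \<le> n then 2 * t else t)"
      by (simp add: w_def val_q_pos flip: powr_add)
    \<comment> \<open>The remaining weight is the smaller of \<open>|q|^t\<close> and
      \<open>|q|^(2t)\<close> for either sign of \<open>t\<close>, so it suits both \<open>h\<close>
      and \<open>k\<close>.\<close>
    also have "(v (h n) + v (k n)) * \<dots> \<le> v (h n) * v q powr t + v (k n) * v q powr (2 * t)"
      unfolding distrib_right
      by (intro add_mono mult_left_mono powr_val_q_mono; simp add: t_def nonneg)
    finally show "v (f n) * v q powr (of_int (if 0 \<le> n then - 1 else 1) * real_of_rat n) \<le>
      v (h n) * v q powr (of_int (if 0 \<le> n then 1 else 1) * real_of_rat n) +
      v (k n) * v q powr (of_int (if 0 \<le> n then 2 else 2) * real_of_rat n)"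
      by (simp add: w_def t_def)
  qed (use h k in \<open>simp_all add: series_def\<close>)
  have "decays 2 1 e"
    by (rule decays_bound[of 1 1 h 2 2 k]) (use h k in \<open>auto simp: series_def e_def nonneg\<close>)
  have "decays 2 1 g"
  proof (rule decays_bound[OF df \<open>decays 2 1 e\<close>])
    fix n :: rat
    define t where "t = real_of_rat n"
    show "v (g n) * v q powr (of_int (if 0 \<le> n then 1 else 2) * real_of_rat n) \<le>
      v (f n) * v q powr (of_int (if 0 \<le> n then - 1 else 1) * real_of_rat n) +
      v (e n) * v q powr (of_int (if 0 \<le> n then 1 else 2) * real_of_rat n)"
    proof (cases "0 \<le> n")
      case True
      have "v (g n) * v q powr t \<le> (v (f n) + v (h n)) * v q powr t"
        by (simp add: g_def mult_right_mono val_diff_le_add)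
      also have "\<dots> \<le> v (f n) * v q powr (- t) + v (h n) * v q powr t"
        unfolding distrib_right using True
        by (intro add_mono mult_left_mono powr_val_q_mono; simp add: t_def nonneg)
      finally show ?thesis
        using True by (simp add: e_def t_def)
    next
      case False
      \<comment> \<open>For negative \<open>n\<close> the formula \<open>g = f - h\<close> would
        require \<open>h\<close> to decay with weight \<open>|q|^(2t)\<close>, but only
        \<open>|q|^t\<close> is given; hence the switch to \<open>g'\<close>.\<close>
      have "v (g n) * v q powr (2 * t) \<le>
          (v (f n) * v q powr (- 3 * t) + v (k n)) * v q powr (2 * t)"
        using val_diff_le_add[of "tate_glue p r f n" "k n"] sf
        by (simp add: g' mult_right_mono val_tate_glue t_def)
      also have "\<dots> = v (f n) * v q powr (- t) + v (k n) * v q powr (2 * t)"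
        by (simp add: distrib_right mult.assoc flip: powr_add)
      also have "\<dots> \<le> v (f n) * v q powr t + v (k n) * v q powr (2 * t)"
        using False by (intro add_mono mult_left_mono powr_val_q_mono; simp add: t_def nonneg)
      finally show ?thesis
        using False by (simp add: e_def t_def)
    qed
  qed
  with df sf sg show ?thesis
    by (intro that[of f g]) (simp_all add: series_def, simp add: g_def, simp add: g')
qed

text \<open>The first component gives \<open>g = f\<close>; the second then says that multiplication
  by \<open>q^(-3n)\<close>, which is not 1 for \<open>n \<noteq> 0\<close>, fixes
  \<open>f n\<close>.\<close>

lemma tate_kernel:
  assumes "f \<in> series 1 (- 1)" and "tate_diff p r 0 (f, g) = (\<lambda>n. 0, \<lambda>n. 0)"
  shows "g = f" and "n \<noteq> 0 \<Longrightarrow> f n = 0"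
proof -
  show gf: "g = f"
    using assms(2) by (auto simp: tate_diff_def fun_eq_iff)
  have "f n * root_pow p r (- 3 * n) = f n"
    using assms(2) gf by (auto simp: tate_diff_def tate_glue_def fun_eq_iff)
  then show "f n = 0" if "n \<noteq> 0"
    using assms(1) root_pow_minus_3_neq_1[OF _ that]
    by (auto simp: series_def elim!: supported_cases[of f n])
qed

section \<open>Cohomology in degree 0, degree 1 and higher degrees\<close>

context
  fixes A :: "int \<Rightarrow> int \<Rightarrow> ('k, rat \<Rightarrow> 'k) module"
  assumes A: "A = (\<lambda>a b. series_algebra v (series a b))"
begin

lemmas complex_defs = tate_cohomology_def cohomology_def cocycles_def coboundaries_def
  a_kernel_def kernel_def tate_cochains_def A

lemma tate_cohomology_0:
  "module_iso ring_of_type_algebra (tate_cohomology p r A 0)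
     (regular_module (ring_of_type_algebra :: 'k ring)) \<noteq> {}"
proof -
  define Z where "Z = {x \<in> series 1 (- 1) \<times> series 2 1. tate_diff p r 0 x = (\<lambda>n. 0, \<lambda>n. 0)}"
  define M where "M = (series_pairs 1 (- 1) 2 1)\<lparr>carrier := Z\<rparr>"
  have H: "tate_cohomology p r A 0 = quotient_module M {(\<lambda>n. 0, \<lambda>n. 0)}"
    by (simp add: complex_defs M_def Z_def module_dirsum_simps series_algebra_simps)
  \<comment> \<open>The 0-cocycles are the constants, embedded diagonally, so the constant term is
    injective on them.\<close>
  have Z_iff: "(f, g) \<in> Z \<longleftrightarrow> g = f \<and> (\<forall>n. n \<noteq> 0 \<longrightarrow> f n = 0)" for f g
  proof
    assume "(f, g) \<in> Z"
    then show "g = f \<and> (\<forall>n. n \<noteq> 0 \<longrightarrow> f n = 0)"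
      using tate_kernel[of f g] by (auto simp: Z_def)
  next
    assume f: "g = f \<and> (\<forall>n. n \<noteq> 0 \<longrightarrow> f n = 0)"
    have "f n * root_pow p r (- 3 * n) = f n" for n
      using f by (cases "n = 0") (simp_all add: root_pow_0)
    with f show "(f, g) \<in> Z"
      by (simp add: Z_def series_at_0 tate_diff_def tate_glue_def fun_eq_iff)
  qed
  have M: "abelian_group M"
    unfolding M_def
    by (rule submodule_abelian_group)
       (auto simp: Z_iff series_at_0 module_dirsum_simps series_algebra_simps)
  show ?thesis
    unfolding H
  proof (rule quotient_module_iso_regular[where h = "\<lambda>x. fst x 0"])
    have "k \<in> (\<lambda>x. fst x 0) ` carrier M" for k
      by (rule image_eqI[of _ _ "(\<lambda>n. if n = 0 then k else 0, \<lambda>n. if n = 0 then k else 0)"])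
         (auto simp: M_def Z_iff)
    then show "(\<lambda>x. fst x 0) ` carrier M = UNIV"
      by auto
    have "x = (\<lambda>n. 0, \<lambda>n. 0)" if "x \<in> Z" "fst x 0 = 0" for x
      using that by (cases x) (auto simp: Z_iff fun_eq_iff, metis)
    then show "{(\<lambda>n. 0, \<lambda>n. 0)} = {x \<in> carrier M. fst x 0 = 0}"
      by (auto simp: M_def Z_iff)
  qed (use M in \<open>auto simp: M_def Z_iff module_dirsum_simps series_algebra_simps\<close>)
qed

text \<open>The difference of the constant terms is the invariant: it kills coboundaries because
  \<open>q^0 = 1\<close>, and \<open>tate_diff_solvable\<close> shows that it kills nothing
  else.\<close>

lemma tate_cohomology_1:
  "module_iso ring_of_type_algebra (tate_cohomology p r A 1)
     (regular_module (ring_of_type_algebra :: 'k ring)) \<noteq> {}"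
proof -
  define Z where "Z = series 1 1 \<times> series 2 2"
  define M where "M = (series_pairs 1 1 2 2)\<lparr>carrier := Z\<rparr>"
  define B where "B = tate_diff p r 0 ` (series 1 (- 1) \<times> series 2 1)"
  \<comment> \<open>Every 1-cochain is a cocycle, since \<open>tate_diff\<close> is zero in degree
    1.\<close>
  have H: "tate_cohomology p r A 1 = quotient_module M B"
    by (simp add: complex_defs M_def Z_def B_def module_dirsum_simps series_algebra_simps)
       (simp add: tate_diff_def split_beta)
  have M: "abelian_group M"
    unfolding M_def
    by (rule submodule_abelian_group)
       (auto simp: Z_def module_dirsum_simps series_algebra_simps series_add series_smult series_at_0)
  show ?thesis
    unfolding H
  proof (rule quotient_module_iso_regular[where h = "\<lambda>x. fst x 0 - snd x 0"])
    show "(\<lambda>x. fst x 0 - snd x 0) ` carrier M = UNIV"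
    proof -
      have "k \<in> (\<lambda>x. fst x 0 - snd x 0) ` carrier M" for k
        by (rule image_eqI[of _ _ "(\<lambda>n. if n = 0 then k else 0, \<lambda>n. 0)"])
           (auto simp: M_def Z_def series_at_0)
      then show ?thesis by auto
    qed
    show "B = {x \<in> carrier M. fst x 0 - snd x 0 = 0}"
    proof (intro equalityI subsetI)
      fix x assume "x \<in> B"
      then show "x \<in> {x \<in> carrier M. fst x 0 - snd x 0 = 0}"
        by (auto simp: B_def M_def Z_def tate_diff_def series_diff_inner series_diff_outer)
           (simp add: tate_glue_def root_pow_0)
    next
      fix x assume "x \<in> {x \<in> carrier M. fst x 0 - snd x 0 = 0}"
      then obtain h k where x: "x = (h, k)" "h \<in> series 1 1" "k \<in> series 2 2" "h 0 = k 0"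
        by (cases x) (auto simp: M_def Z_def)
      then obtain f g where "f \<in> series 1 (- 1)" "g \<in> series 2 1"
        "h = (\<lambda>n. f n - g n)" "k = (\<lambda>n. tate_glue p r f n - g n)"
        by (elim tate_diff_solvable)
      then show "x \<in> B"
        unfolding B_def x by (intro image_eqI[of _ _ "(f, g)"]) (auto simp: tate_diff_def)
    qed
  qed (use M in \<open>auto simp: M_def Z_def module_dirsum_simps series_algebra_simps series_smult
      algebra_simps\<close>)
qed

lemma tate_cohomology_ge_2:
  assumes "2 \<le> i"
  shows "carrier (tate_cohomology p r A i) = {\<zero>\<^bsub>tate_cohomology p r A i\<^esub>}"
proof -
  obtain m where i: "i = Suc (Suc m)"
    using assms by (metis Suc_le_D numeral_2_eq_2 Suc_le_mono)
  \<comment> \<open>The differential is zero here; the zero cochain is exhibited so that its image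
    is not empty.\<close>
  have "tate_diff p r (Suc m) ` carrier (tate_cochains A (Suc m)) = {(\<lambda>n. 0, \<lambda>n. 0)}"
  proof -
    have "(\<lambda>n. 0, \<lambda>n. 0) \<in> carrier (tate_cochains A (Suc m))"
      by (simp add: tate_cochains_def A module_dirsum_simps series_algebra_simps series_at_0)
    then show ?thesis
      by (force simp: tate_diff_def)
  qed
  then show ?thesis
    unfolding tate_cohomology_def cohomology_def i
    by (intro carrier_quotient_module_trivial)
       (auto simp: complex_defs tate_diff_def module_dirsum_simps series_algebra_simps)
qed

end

end

theorem theorem3:
  fixes v :: "'k::field \<Rightarrow> real" and p :: nat and q :: 'k and r :: "nat \<Rightarrow> 'k"
    and A :: "int \<Rightarrow> int \<Rightarrow> ('k, rat \<Rightarrow> 'k) module"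
  assumes "perfectoid_field v p"
    and "0 < v q" and "v q < 1"
    and "r 0 = q" and "\<forall>j. r (Suc j) ^ p = r j"
    and "A = annulus_union v p r \<or> A = annulus_completed v p r"
  shows "\<forall>i. if i = 0 \<or> i = 1
      then module_iso ring_of_type_algebra (tate_cohomology p r A i)
             (regular_module (ring_of_type_algebra :: 'k ring)) \<noteq> {}
      else carrier (tate_cohomology p r A i) = {\<zero>\<^bsub>tate_cohomology p r A i\<^esub>}"
proof -
  interpret tate_curve v p q r
    using assms by (simp add: tate_curve_def tate_curve_axioms_def)
  \<comment> \<open>Both readings of the annulus rings are instances of \<open>tate_cover\<close>: a
    chain of exponent sets with bounded denominators, or the single set Z[1/p].\<close>
  obtain \<E> where \<E>: "tate_cover v p q r \<E>"
    and A: "A = (\<lambda>a b. series_algebra v (tate_cover.series v q \<E> a b))"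
    using assms(6)
  proof
    assume "A = annulus_union v p r"
    interpret cover: tate_cover v p q r "range (p_inv_ints p)"
    proof
      fix E F assume "E \<in> range (p_inv_ints p)" "F \<in> range (p_inv_ints p)"
      then obtain i j where "E = p_inv_ints p i" "F = p_inv_ints p j" by auto
      then show "\<exists>G\<in>range (p_inv_ints p). E \<union> F \<subseteq> G"
        using p_inv_ints_mono[of i "max i j"] p_inv_ints_mono[of j "max i j"] by auto
    qed (auto simp: zero_in_p_inv_ints)
    have "(\<Union>j. annulus_series v p r (p_inv_ints p j) a b) = cover.series a b" for a b
      by (auto simp: annulus_series_iff[OF cover.exponents] cover.series_def cover.supported_def) blast
    then show ?thesis
      using that[OF cover.tate_cover_axioms] \<open>A = annulus_union v p r\<close>
      by (simp add: annulus_union_def fun_eq_iff)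
  next
    assume "A = annulus_completed v p r"
    interpret cover: tate_cover v p q r "{\<Union>j. p_inv_ints p j}"
      by unfold_locales (auto simp: zero_in_p_inv_ints)
    have "annulus_series v p r (\<Union>j. p_inv_ints p j) a b = cover.series a b" for a b
      by (auto simp: annulus_series_iff[OF cover.exponents] cover.series_def cover.supported_def)
    then show ?thesis
      using that[OF cover.tate_cover_axioms] \<open>A = annulus_completed v p r\<close>
      by (simp add: annulus_completed_def fun_eq_iff)
  qed
  interpret tate_cover v p q r \<E> by (fact \<E>)
  have "carrier (tate_cohomology p r A i) = {\<zero>\<^bsub>tate_cohomology p r A i\<^esub>}"
    if "\<not> (i = 0 \<or> i = 1)" for i
    using that by (intro tate_cohomology_ge_2[OF A]) auto
  then show ?thesis
    using tate_cohomology_0[OF A] tate_cohomology_1[OF A] by auto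
qed

end
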